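(* Fix a positive integer $n$ and a field $k$, let $S=k[x_1,\ldots,x_n]$, and let $p=p(D)\in[0,1]$ be a function of $D$. For each positive integer $D$ let $M\sim\mathcal{M}(n,D,p)$ be a random monomial ideal. If $D^{-n+1}\ll p\ll 1$, then asymptotically almost surely, as $D\to\infty$, $S/M$ is not Cohen-Macaulay.
   Context: The model $\mathcal{M}(n,D,p)$: a random set $G$ of monomials of $S=k[x_1,\ldots,x_n]$ is obtained by including each monomial of total degree exactly $D$ in $G$ independently with probability $p$ (and no other monomials); then $M=\langle G\rangle$ (so $M=\langle 0\rangle$ if $G=\emptyset$). Here $n$ is fixed and $p$ may depend on $D$. For functions $f,g$ of $D$, $f\ll g$ (equivalently $g\gg f$) means $\lim_{D\to\infty}f(D)/g(D)=0$. An event holds asymptotically almost surely if its probability tends to $1$ as $D\to\infty$. $S/M$ is Cohen-Macaulay if $\dim(S/M)=\operatorname{depth}(S/M)$; as $S$ is a polynomial ring this is equivalent to $\dim(S/M)=n-\operatorname{pdim}(S/M)$, where $\dim$ is Krull dimension and $\operatorname{pdim}$ is projective dimension over $S$. *)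

theory Defs
  imports
    "HOL-Library.Poly_Mapping"
    "HOL-Library.Landau_Symbols"
    "HOL-Library.Extended_Nat"
    "HOL-Algebra.QuotRing"
    "HOL-Algebra.Module"
    "HOL-Algebra.Algebraic_Closure_Type"
    "HOL-Probability.Probability"
begin

section \<open>Dimension and depth\<close>

text \<open>
  The suprema below are taken in \<^typ>\<open>enat\<close>, where the supremum of the empty set is 0. The empty
  set arises only for the zero ring and the zero module, so the conventions
  dim 0 = -infinity and depth 0 = infinity are not reproduced.
\<close>

definition krull_dim :: "('a, 'b) ring_scheme \<Rightarrow> enat" where
  "krull_dim R = Sup {enat m | m.
     \<exists>P :: nat \<Rightarrow> 'a set. (\<forall>i\<le>m. primeideal (P i) R) \<and> (\<forall>i<m. P i \<subset> P (Suc i))}"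

text \<open>The submodule \<open>(f\<^sub>1, \<dots>, f\<^sub>r) N\<close> of \<open>N\<close>.\<close>

definition seq_submodule :: "('a, 'b, 'c) module_scheme \<Rightarrow> 'a list \<Rightarrow> 'b set" where
  "seq_submodule N fs =
     {(\<Oplus>\<^bsub>N\<^esub>i\<in>{..<length fs}. (fs ! i) \<odot>\<^bsub>N\<^esub> v i) | v. v \<in> {..<length fs} \<rightarrow> carrier N}"

text \<open>
  That \<open>f\<^sub>i\<close> is a nonzerodivisor on \<open>N / (f\<^sub>1, \<dots>, f\<^bsub>i-1\<^esub>) N\<close> is expressed
  on representatives in \<open>N\<close>.
\<close>

definition regular_sequence :: "('a, 'b, 'c) module_scheme \<Rightarrow> 'a list \<Rightarrow> bool" where
  "regular_sequence N fs \<longleftrightarrow>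
     (\<forall>i<length fs. \<forall>x\<in>carrier N.
        (fs ! i) \<odot>\<^bsub>N\<^esub> x \<in> seq_submodule N (take i fs) \<longrightarrow> x \<in> seq_submodule N (take i fs)) \<and>
     seq_submodule N fs \<noteq> carrier N"

definition depth :: "'a set \<Rightarrow> ('a, 'b, 'c) module_scheme \<Rightarrow> enat" where
  "depth I N = Sup {enat (length fs) | fs. set fs \<subseteq> I \<and> regular_sequence N fs}"

definition quot_module :: "('a, 'b) ring_scheme \<Rightarrow> 'a set \<Rightarrow> ('a, 'a set) module" where
  "quot_module R I =
     \<lparr>carrier = carrier (R Quot I), monoid.mult = (\<otimes>\<^bsub>R Quot I\<^esub>), one = \<one>\<^bsub>R Quot I\<^esub>,
      ring.zero = \<zero>\<^bsub>R Quot I\<^esub>, add = (\<oplus>\<^bsub>R Quot I\<^esub>),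
      module.smult = (\<lambda>r A. (I +>\<^bsub>R\<^esub> r) \<otimes>\<^bsub>R Quot I\<^esub> A)\<rparr>"


section \<open>Quotients of the polynomial ring\<close>

text \<open>
  Polynomials are finitely supported maps from exponent vectors to coefficients; the
  indeterminates are indexed by the finite type \<open>'n\<close>, so their number is \<open>CARD('n)\<close>.
\<close>

type_synonym ('n, 'k) mpoly = "('n \<Rightarrow>\<^sub>0 nat) \<Rightarrow>\<^sub>0 'k"

definition mpoly_ring :: "('n::finite, 'k::field) mpoly ring" where
  "mpoly_ring = ring_of_type_algebra"

definition monomial :: "('n::finite \<Rightarrow>\<^sub>0 nat) \<Rightarrow> ('n, 'k::field) mpoly" where
  "monomial a = Poly_Mapping.single a 1"

definition irrelevant_ideal :: "('n::finite, 'k::field) mpoly set" where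
  "irrelevant_ideal = Idl\<^bsub>mpoly_ring\<^esub> (range (\<lambda>i. monomial (Poly_Mapping.single i 1)))"

text \<open>
  The depth of the graded \<open>S\<close>-module \<open>S/M\<close> is taken with respect to
  the homogeneous maximal ideal.
\<close>

definition cohen_macaulay_quot :: "('n::finite, 'k::field) mpoly set \<Rightarrow> bool" where
  "cohen_macaulay_quot M \<longleftrightarrow>
     krull_dim (mpoly_ring Quot M) = depth irrelevant_ideal (quot_module mpoly_ring M)"


section \<open>Random monomial ideals\<close>

definition monomials_of_degree :: "nat \<Rightarrow> ('n::finite, 'k::field) mpoly set" where
  "monomials_of_degree D = monomial ` {a. (\<Sum>i\<in>UNIV. Poly_Mapping.lookup a i) = D}"

text \<open>\<^const>\<open>Pi_pmf\<close> is a product distribution only over a finite index set.\<close>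

lemma finite_monomials_of_degree: "finite (monomials_of_degree D)"
proof -
  let ?A = "{a :: 'a \<Rightarrow>\<^sub>0 nat. (\<Sum>i\<in>UNIV. Poly_Mapping.lookup a i) = D}"
  have "Poly_Mapping.lookup a i \<le> D" if "a \<in> ?A" for a i
    using that member_le_sum[of i UNIV "Poly_Mapping.lookup a"] by simp
  then have "Poly_Mapping.lookup ` ?A \<subseteq> PiE UNIV (\<lambda>_. {..D})"
    by (intro image_subsetI) (simp add: PiE_iff)
  then have "finite (Poly_Mapping.lookup ` ?A)"
    by (rule finite_subset) (intro finite_PiE finite_atMost finite)
  moreover have "inj_on Poly_Mapping.lookup ?A"
    by (rule inj_onI) (simp add: poly_mapping_eqI)
  ultimately show ?thesis
    unfolding monomials_of_degree_def by (intro finite_imageI) (rule finite_imageD)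
qed

definition random_monomials :: "nat \<Rightarrow> real \<Rightarrow> ('n::finite, 'k::field) mpoly set pmf" where
  "random_monomials D q =
     map_pmf (\<lambda>b. {m \<in> monomials_of_degree D. b m})
       (Pi_pmf (monomials_of_degree D) False (\<lambda>_. bernoulli_pmf q))"

definition random_monomial_ideal :: "nat \<Rightarrow> real \<Rightarrow> ('n::finite, 'k::field) mpoly set pmf" where
  "random_monomial_ideal D q = map_pmf (\<lambda>G. Idl\<^bsub>mpoly_ring\<^esub> G) (random_monomials D q)"

end

(*
  Let q = (D - 1) div n. The monomial with all exponents q has degree less than D, so it never
  lies in M. For each i there are at least (q + 1)^(n-1) >= (D/n)^(n-1) monomials of degree D
  whose exponents other than the i-th are at most q; as p D^(n-1) tends to infinity, G asymptotically
  almost surely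
  meets all n of these families. Then a power of every variable multiplies the balanced
  monomial into M, so S/M has a nonzero socle and depth 0. On the other hand, x_i^D is not in G with
  probability 1 - p, and then M lies in the primes (x_j | j ~= i) and (x_1, ..., x_n), so
  dim S/M >= 1.
*)

theory Submission
  imports Defs
begin

section \<open>Dimension and depth of quotients\<close>

text \<open>As \<open>I \<subseteq> P\<close>, the ideal \<open>P\<close> is a union of cosets of
  \<open>I\<close>. Hence a coset lies in the image of \<open>P\<close> only if its representatives
  lie in \<open>P\<close>, and primality passes to the quotient.\<close>

lemma (in cring) primeideal_image_Quot:
  assumes I: "ideal I R" and P: "primeideal P R" and IP: "I \<subseteq> P"
  shows "primeideal ((+>) I ` P) (R Quot I)"
proof -
  interpret I: ideal I R by fact
  interpret P: primeideal P R by fact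
  have mem: "a \<in> P" if "a \<in> carrier R" "I +> a \<in> (+>) I ` P" for a
  proof -
    have "a \<in> I +> a"
      using I.a_rcos_self that(1) by simp
    moreover have "\<Union> ((+>) I ` P) = P"
      using ideal_incl_iff[OF I P.is_ideal] IP by blast
    ultimately show ?thesis
      using that(2) by blast
  qed
  have carr: "carrier (R Quot I) = (+>) I ` carrier R"
    by (auto simp: FactRing_simps)
  show ?thesis
  proof (rule primeidealI)
    show "ideal ((+>) I ` P) (R Quot I)"
      using ring_ideal_imp_quot_ideal[OF I P.is_ideal] .
    show "cring (R Quot I)"
      by (rule I.quotient_is_cring[OF is_cring])
    show "carrier (R Quot I) \<noteq> (+>) I ` P"
      using mem P.I_notcarr P.a_subset unfolding carr by blast
  next
    fix U V
    assume "U \<in> carrier (R Quot I)" "V \<in> carrier (R Quot I)"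
    then obtain a b where ab: "a \<in> carrier R" "b \<in> carrier R" "U = I +> a" "V = I +> b"
      unfolding carr by blast
    assume "U \<otimes>\<^bsub>R Quot I\<^esub> V \<in> (+>) I ` P"
    moreover have "U \<otimes>\<^bsub>R Quot I\<^esub> V = I +> (a \<otimes> b)"
      using ab I.rcoset_mult_add by (simp add: FactRing_def)
    ultimately have "I +> (a \<otimes> b) \<in> (+>) I ` P"
      by metis
    then have "a \<otimes> b \<in> P"
      by (intro mem m_closed ab(1,2))
    then show "U \<in> (+>) I ` P \<or> V \<in> (+>) I ` P"
      using P.I_prime ab by blast
  qed
qed

lemma (in cring) one_le_krull_dim_Quot:
  assumes I: "ideal I R" and P: "primeideal P R" and Q: "primeideal Q R"
    and "I \<subseteq> P" "P \<subset> Q"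
  shows "1 \<le> krull_dim (R Quot I)"
proof -
  let ?im = "\<lambda>J. (+>) I ` J"
  define C where "C = (\<lambda>i::nat. if i = 0 then ?im P else ?im Q)"
  have PI: "ideal P R" and QI: "ideal Q R"
    using P Q by (auto simp: primeideal_def)
  \<comment> \<open>Each ideal is the union of its image, so distinct ideals have distinct images
    and the inclusion stays strict.\<close>
  have "P = \<Union> (?im P)" "Q = \<Union> (?im Q)"
    using ideal_incl_iff[OF I PI] ideal_incl_iff[OF I QI] assms(4,5) by blast+
  with assms(5) have "?im P \<noteq> ?im Q"
    by (metis psubsetE order_refl)
  with assms(5) have "?im P \<subset> ?im Q"
    by (metis image_mono psubset_eq)
  then have "\<forall>i<1. C i \<subset> C (Suc i)"
    by (simp add: C_def)
  moreover have "\<forall>i\<le>1. primeideal (C i) (R Quot I)"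
    using primeideal_image_Quot[OF I P] primeideal_image_Quot[OF I Q] assms(4,5)
    by (auto simp: C_def)
  ultimately have "enat 1 \<le> krull_dim (R Quot I)"
    unfolding krull_dim_def by (intro Sup_upper CollectI exI[of _ 1] exI[of _ C] conjI) simp_all
  then show ?thesis
    by (simp add: one_enat_def)
qed

text \<open>The class of \<open>s\<close> is nonzero and killed by all of \<open>J\<close>, so no
  element of \<open>J\<close> can be the first entry of a regular sequence.\<close>

lemma (in cring) depth_quot_module_eq_0:
  assumes I: "ideal I R" and s: "s \<in> carrier R" "s \<notin> I"
    and J: "J \<subseteq> carrier R" "\<And>f. f \<in> J \<Longrightarrow> f \<otimes> s \<in> I"
  shows "depth J (quot_module R I) = 0"
proof -
  interpret I: ideal I R by fact
  let ?N = "quot_module R I"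
  have Icarr: "I \<in> carrier ?N"
    using ring.ring_simprules(2)[OF I.quotient_is_ring]
    by (simp add: quot_module_def FactRing_def)
  \<comment> \<open>The empty sequence generates the zero submodule, whose only element is the coset
    \<open>I\<close>. Regularity at index 0 is tested against it.\<close>
  have sub: "seq_submodule ?N [] = {I}"
    using Icarr
    by (auto simp: seq_submodule_def finsum_def finprod_def quot_module_def FactRing_def)
  have scarr: "I +> s \<in> carrier ?N"
    using s by (auto simp: quot_module_def FactRing_simps)
  have sI: "I +> s \<noteq> I"
    using s I.a_rcos_self by blast
  have "fs = []" if fs: "set fs \<subseteq> J" "regular_sequence ?N fs" for fs
  proof (rule ccontr)
    assume ne: "fs \<noteq> []"
    then have f: "fs ! 0 \<in> J"
      using fs(1) by auto
    then have "(fs ! 0) \<odot>\<^bsub>?N\<^esub> (I +> s) = I +> (fs ! 0 \<otimes> s)"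
      using J(1) s(1) I.rcoset_mult_add by (auto simp: quot_module_def FactRing_def)
    also have "\<dots> = I"
      using J(2)[OF f] by (simp add: I.a_rcos_const)
    finally have "(fs ! 0) \<odot>\<^bsub>?N\<^esub> (I +> s) \<in> seq_submodule ?N (take 0 fs)"
      by (simp add: sub)
    then have "I +> s \<in> seq_submodule ?N (take 0 fs)"
      using fs(2) ne scarr unfolding regular_sequence_def by blast
    then show False
      using sI by (simp add: sub)
  qed
  \<comment> \<open>Only length 0 can occur, so the bound holds whether or not the empty sequence is
    regular.\<close>
  then have "depth J ?N \<le> 0"
    unfolding depth_def by (intro Sup_least) (auto simp: zero_enat_def)
  then show ?thesis
    by simp
qed


section \<open>Monomial ideals\<close>

lemma poly_mapping_add_induct [case_names zero single add]:
  assumes "P 0" "\<And>a c. P (Poly_Mapping.single a c)" "\<And>f g. P f \<Longrightarrow> P g \<Longrightarrow> P (f + g)"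
  shows "P (f :: 'a \<Rightarrow>\<^sub>0 'b::comm_monoid_add)"
proof (induction f rule: update_induct)
  case const
  show ?case by (rule assms(1))
next
  case (update f a b)
  \<comment> \<open>The key \<open>a\<close> is new to \<open>f\<close>, so updating there amounts
    to adding a term.\<close>
  have "Poly_Mapping.update a b f = f + Poly_Mapping.single a b"
    using update(1)
    by (intro poly_mapping_eqI) (auto simp: Poly_Mapping.lookup_update lookup_add lookup_single in_keys_iff when_def)
  then show ?case
    using assms(2,3) update by simp
qed

text \<open>Both sides are additive in \<open>f\<close> and in \<open>g\<close> separately, so
  agreement on pairs of terms suffices.\<close>

lemma poly_mapping_multiplicativeI:
  fixes h :: "('a::comm_monoid_add \<Rightarrow>\<^sub>0 'b::comm_semiring_0) \<Rightarrow> 'c::comm_semiring_0"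
  assumes add: "\<And>f g. h (f + g) = h f + h g" and zero: "h 0 = 0"
    and single: "\<And>a b c d. h (Poly_Mapping.single a c * Poly_Mapping.single b d) =
      h (Poly_Mapping.single a c) * h (Poly_Mapping.single b d)"
  shows "h (f * g) = h f * h g"
proof (induction f rule: poly_mapping_add_induct)
  case (single a c)
  show ?case
    by (induction g rule: poly_mapping_add_induct) (simp_all add: add zero assms(3) distrib_left)
qed (simp_all add: add zero distrib_right)

section \<open>Ideals and primes of the polynomial ring\<close>

lemma cring_mpoly_ring: "cring mpoly_ring"
  unfolding mpoly_ring_def by (rule cring_from_type_algebra)

lemma mpoly_ring_simps [simp]:
  "carrier mpoly_ring = UNIV" "f \<otimes>\<^bsub>mpoly_ring\<^esub> g = f * g" "f \<oplus>\<^bsub>mpoly_ring\<^esub> g = f + g"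
  "\<one>\<^bsub>mpoly_ring\<^esub> = 1" "\<zero>\<^bsub>mpoly_ring\<^esub> = 0"
  by (simp_all add: mpoly_ring_def ring_of_type_algebra_def)

lemma ideal_mpoly_ringI:
  fixes I :: "('n::finite, 'k::field) mpoly set"
  assumes "0 \<in> I" "\<And>f g. f \<in> I \<Longrightarrow> g \<in> I \<Longrightarrow> f + g \<in> I" "\<And>f g. f \<in> I \<Longrightarrow> g * f \<in> I"
  shows "ideal I mpoly_ring"
proof -
  interpret cring "mpoly_ring :: ('n, 'k) mpoly ring" by (rule cring_mpoly_ring)
  have minus: "\<ominus>\<^bsub>mpoly_ring\<^esub> f = - f" for f :: "('n, 'k) mpoly"
    by (rule minus_equality) simp_all
  have "subgroup I (add_monoid mpoly_ring)"
  proof (rule add.subgroupI)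
    show "\<ominus>\<^bsub>mpoly_ring\<^esub> f \<in> I" if "f \<in> I" for f
      using assms(3)[OF that, of "-1"] by (simp add: minus)
  qed (use assms in auto)
  then show ?thesis
    using assms by (intro idealI ring_axioms) (auto simp: mult.commute)
qed

text \<open>The target is a domain, so a product mapped to 0 has a factor mapped to 0;
  \<open>h 1 = 1\<close> makes the kernel proper.\<close>

lemma primeideal_mpoly_ring_kernel:
  fixes h :: "('n::finite, 'k::field) mpoly \<Rightarrow> 'a::idom"
  assumes add: "\<And>f g. h (f + g) = h f + h g" and mult: "\<And>f g. h (f * g) = h f * h g"
    and one: "h 1 = 1"
  shows "primeideal {f. h f = 0} mpoly_ring"
proof (rule primeidealI)
  have "h 0 = 0"
    using add[of 0 0] by (metis add_0_right add_cancel_left_right)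
  then show "ideal {f. h f = 0} mpoly_ring"
    by (intro ideal_mpoly_ringI) (auto simp: add mult)
  have "1 \<notin> {f. h f = 0}"
    using one by simp
  then show "carrier mpoly_ring \<noteq> {f. h f = 0}"
    unfolding mpoly_ring_simps by blast
qed (auto simp: cring_mpoly_ring mult)

section \<open>Restriction to a coordinate axis and the constant term\<close>

lemma inj_single_one_variable: "inj (Poly_Mapping.single i :: nat \<Rightarrow> _)"
  by (rule injI) (metis lookup_single_eq)

text \<open>Exponents are nonnegative, so nothing cancels: a sum lies on the axis only if both
  summands do. This is what makes restriction to the axis multiplicative.\<close>

lemma add_eq_single_iff:
  fixes a b :: "'n \<Rightarrow>\<^sub>0 nat"
  shows "a + b = Poly_Mapping.single i m \<longleftrightarrow>
    (\<exists>k l. a = Poly_Mapping.single i k \<and> b = Poly_Mapping.single i l \<and> k + l = m)"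
proof
  assume eq: "a + b = Poly_Mapping.single i m"
  have sum: "Poly_Mapping.lookup a j + Poly_Mapping.lookup b j = (m when i = j)" for j
    using arg_cong[OF eq, of "\<lambda>c. Poly_Mapping.lookup c j"] by (simp add: lookup_add lookup_single)
  then have "Poly_Mapping.lookup a j = 0" "Poly_Mapping.lookup b j = 0" if "i \<noteq> j" for j
    using that by (metis add_is_0 when_simps(2))+
  then have "a = Poly_Mapping.single i (Poly_Mapping.lookup a i)"
    and "b = Poly_Mapping.single i (Poly_Mapping.lookup b i)"
    by (auto intro!: poly_mapping_eqI simp: lookup_single when_def)
  then show "\<exists>k l. a = Poly_Mapping.single i k \<and> b = Poly_Mapping.single i l \<and> k + l = m"
    using sum[of i] by auto
qed (auto simp: single_add)

text \<open>The substitution x_j = 0 for all j other than i, with values in k[x_i].\<close>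

abbreviation restrict_to_axis :: "'n \<Rightarrow> ('n::finite, 'k::field) mpoly \<Rightarrow> (nat \<Rightarrow>\<^sub>0 'k)" where
  "restrict_to_axis i \<equiv> Poly_Mapping.map_key (Poly_Mapping.single i)"

lemma lookup_restrict_to_axis:
  "Poly_Mapping.lookup (restrict_to_axis i f) m = Poly_Mapping.lookup f (Poly_Mapping.single i m)"
  by (simp add: map_key.rep_eq inj_single_one_variable)

lemma restrict_to_axis_mult:
  fixes f g :: "('n::finite, 'k::field) mpoly"
  shows "restrict_to_axis i (f * g) = restrict_to_axis i f * restrict_to_axis i g"
proof (rule poly_mapping_multiplicativeI)
  fix a b :: "'n \<Rightarrow>\<^sub>0 nat" and c d :: 'k
  have off: "restrict_to_axis i (Poly_Mapping.single a c) = 0"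
    if "a \<notin> range (Poly_Mapping.single i)" for a and c :: 'k
    by (rule poly_mapping_eqI) (use that in \<open>auto simp: lookup_restrict_to_axis lookup_single when_def\<close>)
  show "restrict_to_axis i (Poly_Mapping.single a c * Poly_Mapping.single b d) =
    restrict_to_axis i (Poly_Mapping.single a c) * restrict_to_axis i (Poly_Mapping.single b d)"
  proof (cases "a \<in> range (Poly_Mapping.single i) \<and> b \<in> range (Poly_Mapping.single i)")
    case True
    then show ?thesis
      by (auto simp: mult_single single_add[symmetric] map_key_single inj_single_one_variable)
  next
    case False
    then have "a + b \<notin> range (Poly_Mapping.single i)"
      by (auto simp: add_eq_single_iff dest: sym)
    with False show ?thesis
      by (auto simp: mult_single off)
  qed
qed (simp_all add: map_key_plus inj_single_one_variable)

text \<open>The constant term is evaluation at the origin; on terms, a sum of exponents vanishes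
  only if both do.\<close>

lemma lookup_0_mult:
  fixes f g :: "('n::finite, 'k::field) mpoly"
  shows "Poly_Mapping.lookup (f * g) 0 = Poly_Mapping.lookup f 0 * Poly_Mapping.lookup g 0"
proof (rule poly_mapping_multiplicativeI[where h = "\<lambda>f. Poly_Mapping.lookup f 0"])
  fix a b :: "'n \<Rightarrow>\<^sub>0 nat" and c d :: 'k
  have "a + b = 0 \<longleftrightarrow> a = 0 \<and> b = 0"
    by (auto simp: poly_mapping_eq_iff fun_eq_iff lookup_add)
  then show "Poly_Mapping.lookup (Poly_Mapping.single a c * Poly_Mapping.single b d) 0 =
    Poly_Mapping.lookup (Poly_Mapping.single a c) 0 * Poly_Mapping.lookup (Poly_Mapping.single b d) 0"
    by (auto simp: mult_single lookup_single when_def)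
qed (simp_all add: lookup_add)

text \<open>The chain is (x_j | j ~= i) inside (x_1, ..., x_n), obtained as kernels of restriction
  to the axis and of the constant term. A generator that is not a power of x_i restricts to 0, so
  the ideal lies in the smaller prime.\<close>

lemma one_le_krull_dim_monomial_quot:
  fixes A :: "('n::finite \<Rightarrow>\<^sub>0 nat) set"
  assumes "\<And>m. Poly_Mapping.single i m \<notin> A"
  shows "1 \<le> krull_dim ((mpoly_ring :: ('n, 'k::field) mpoly ring) Quot
    (Idl\<^bsub>mpoly_ring\<^esub> (monomial ` A)))"
proof -
  interpret cring "mpoly_ring :: ('n, 'k) mpoly ring" by (rule cring_mpoly_ring)
  let ?P = "{f :: ('n, 'k) mpoly. restrict_to_axis i f = 0}"
  let ?Q = "{f :: ('n, 'k) mpoly. Poly_Mapping.lookup f 0 = 0}"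
  have "restrict_to_axis i (1 :: ('n, 'k) mpoly) = 1"
    by (rule poly_mapping_eqI)
      (auto simp: lookup_restrict_to_axis lookup_one when_def poly_mapping_eq_iff fun_eq_iff lookup_single)
  then have P: "primeideal ?P mpoly_ring"
    by (intro primeideal_mpoly_ring_kernel restrict_to_axis_mult)
      (simp_all add: map_key_plus inj_single_one_variable)
  have Q: "primeideal ?Q mpoly_ring"
    by (intro primeideal_mpoly_ring_kernel lookup_0_mult) (simp_all add: lookup_add)
  have "?P \<subseteq> ?Q"
    by (auto simp: lookup_restrict_to_axis[of i _ 0, simplified, symmetric])
  \<comment> \<open>The variable x_i separates the two primes.\<close>
  moreover have "monomial (Poly_Mapping.single i 1) \<in> ?Q - ?P"
    by (auto simp: monomial_def lookup_single map_key_single inj_single_one_variable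
        when_def poly_mapping_eq_iff fun_eq_iff)
  ultimately have "?P \<subset> ?Q"
    by blast
  moreover have "restrict_to_axis i (monomial a :: ('n, 'k) mpoly) = 0" if "a \<in> A" for a
    by (rule poly_mapping_eqI)
      (use assms that in \<open>auto simp: lookup_restrict_to_axis monomial_def lookup_single when_def\<close>)
  then have "Idl\<^bsub>mpoly_ring\<^esub> (monomial ` A) \<subseteq> ?P"
    using P by (intro genideal_minimal) (auto simp: primeideal_def)
  moreover have "ideal (Idl\<^bsub>mpoly_ring\<^esub> (monomial ` A)) (mpoly_ring :: ('n, 'k) mpoly ring)"
    by (rule genideal_ideal) simp
  ultimately show ?thesis
    using one_le_krull_dim_Quot P Q by blast
qed

section \<open>Membership of monomials in a monomial ideal, and socle elements\<close>

definition exponent_dvd :: "('n \<Rightarrow>\<^sub>0 nat) \<Rightarrow> ('n \<Rightarrow>\<^sub>0 nat) \<Rightarrow> bool" where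
  "exponent_dvd a b \<longleftrightarrow> (\<forall>i. Poly_Mapping.lookup a i \<le> Poly_Mapping.lookup b i)"

text \<open>The polynomials all of whose terms are divisible by a generator form an ideal
  \<open>?J\<close> containing the generators, hence containing \<open>?M\<close>. Conversely x^t is
  x^(t-a) times x^a.\<close>

lemma monomial_in_Idl_iff:
  fixes A :: "('n::finite \<Rightarrow>\<^sub>0 nat) set"
  shows "(monomial t :: ('n, 'k::field) mpoly) \<in> Idl\<^bsub>mpoly_ring\<^esub> (monomial ` A) \<longleftrightarrow>
    (\<exists>a\<in>A. exponent_dvd a t)"
proof -
  interpret cring "mpoly_ring :: ('n, 'k) mpoly ring" by (rule cring_mpoly_ring)
  let ?M = "Idl\<^bsub>mpoly_ring\<^esub> (monomial ` A) :: ('n, 'k) mpoly set"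
  let ?J = "{f :: ('n, 'k) mpoly. \<forall>b\<in>Poly_Mapping.keys f. \<exists>a\<in>A. exponent_dvd a b}"
  interpret M: ideal ?M mpoly_ring
    by (rule genideal_ideal) simp
  have "ideal ?J mpoly_ring"
  proof (rule ideal_mpoly_ringI)
    show "f + g \<in> ?J" if "f \<in> ?J" "g \<in> ?J" for f g
      using that keys_add[of f g] by blast
  next
    fix f g assume f: "f \<in> ?J"
    have "\<exists>a\<in>A. exponent_dvd a (b + c)" if c: "c \<in> Poly_Mapping.keys f" for b c
    proof -
      obtain a where "a \<in> A" "exponent_dvd a c"
        using f c by blast
      then show ?thesis
        by (intro bexI[of _ a]) (simp_all add: exponent_dvd_def lookup_add trans_le_add2)
    qed
    then show "g * f \<in> ?J"
      using keys_mult[of g f] by blast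
  qed simp
  then have "?M \<subseteq> ?J"
    by (rule genideal_minimal) (auto simp: monomial_def exponent_dvd_def)
  moreover have "monomial t \<in> ?M" if a: "a \<in> A" "exponent_dvd a t" for a
  proof -
    \<comment> \<open>The truncated subtraction is exact because \<open>a\<close> is bounded by
      \<open>t\<close> in every entry.\<close>
    have "t = (t - a) + a"
      using a(2) by (intro poly_mapping_eqI) (simp add: lookup_add lookup_minus exponent_dvd_def)
    then have "monomial t = (monomial (t - a) * monomial a :: ('n, 'k) mpoly)"
      by (simp add: monomial_def mult_single)
    moreover have "monomial a \<in> ?M"
      using genideal_self[of "monomial ` A"] a(1) by auto
    ultimately show ?thesis
      using M.I_l_closed[of "monomial a" "monomial (t - a)"] by simp
  qed
  ultimately show ?thesis
    by (force simp: monomial_def)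
qed

text \<open>
  The hypothesis on \<open>c\<close> says that a power of every variable multiplies the class of
  \<open>x\<^sup>c\<close> into the ideal, so a multiple of \<open>x\<^sup>c\<close> of maximal degree outside the ideal is a
  socle element.
\<close>

lemma depth_monomial_quot_eq_0:
  fixes A :: "('n::finite \<Rightarrow>\<^sub>0 nat) set"
  assumes c: "\<And>a. a \<in> A \<Longrightarrow> \<not> exponent_dvd a c"
    and cone: "\<And>i. \<exists>a\<in>A. \<forall>j. j \<noteq> i \<longrightarrow> Poly_Mapping.lookup a j \<le> Poly_Mapping.lookup c j"
  shows "depth irrelevant_ideal (quot_module (mpoly_ring :: ('n, 'k::field) mpoly ring)
    (Idl\<^bsub>mpoly_ring\<^esub> (monomial ` A))) = 0"
proof -
  interpret cring "mpoly_ring :: ('n, 'k) mpoly ring" by (rule cring_mpoly_ring)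
  let ?M = "Idl\<^bsub>mpoly_ring\<^esub> (monomial ` A) :: ('n, 'k) mpoly set"
  interpret M: ideal ?M mpoly_ring
    by (rule genideal_ideal) simp
  obtain w where w: "\<And>i. w i \<in> A" "\<And>i j. j \<noteq> i \<Longrightarrow> Poly_Mapping.lookup (w i) j \<le> Poly_Mapping.lookup c j"
    using cone by metis
  \<comment> \<open>The multiples of x^c outside the ideal. Their degrees are bounded: if
    \<open>t\<close> exceeded \<open>w i\<close> in entry \<open>i\<close>, then \<open>w i\<close>
    would divide \<open>t\<close>, since elsewhere \<open>w i\<close> is at most \<open>c\<close>
    and \<open>c\<close> at most \<open>t\<close>.\<close>
  define T where "T = (\<lambda>t. exponent_dvd c t \<and> (\<forall>a\<in>A. \<not> exponent_dvd a t))"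
  define deg where "deg = (\<lambda>t :: 'n \<Rightarrow>\<^sub>0 nat. \<Sum>i\<in>UNIV. Poly_Mapping.lookup t i)"
  have "deg t < Suc (\<Sum>i\<in>UNIV. Poly_Mapping.lookup (w i) i)" if t: "T t" for t
  proof -
    have "Poly_Mapping.lookup t i \<le> Poly_Mapping.lookup (w i) i" for i
    proof (rule ccontr)
      assume "\<not> Poly_Mapping.lookup t i \<le> Poly_Mapping.lookup (w i) i"
      then have "exponent_dvd (w i) t"
        using w(2)[of _ i] t unfolding T_def exponent_dvd_def
        by (metis le_trans nat_le_linear)
      then show False
        using t w(1) by (auto simp: T_def)
    qed
    then show ?thesis
      by (auto simp: deg_def less_Suc_eq_le intro: sum_mono)
  qed
  moreover have "T c"
    using c by (auto simp: T_def exponent_dvd_def)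
  ultimately obtain s where s: "T s" "\<And>t. T t \<Longrightarrow> deg t \<le> deg s"
    using ex_has_greatest_nat[of T c deg] by blast
  let ?s = "monomial s :: ('n, 'k) mpoly"
  have socle: "monomial (Poly_Mapping.single i 1) * ?s \<in> ?M" for i
  proof -
    let ?t = "Poly_Mapping.single i 1 + s"
    \<comment> \<open>By maximality of the degree of \<open>s\<close>, multiplying by any variable
      leaves \<open>T\<close>; the product is still a multiple of x^c, so it lies in the
      ideal.\<close>
    have "deg ?t = Suc (deg s)"
      by (simp add: deg_def lookup_add sum.distrib lookup_single when_def)
    then have "\<not> T ?t"
      using s(2)[of ?t] by auto
    moreover have "exponent_dvd c ?t"
      using s(1) by (simp add: T_def exponent_dvd_def lookup_add trans_le_add2)
    ultimately have "monomial ?t \<in> ?M"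
      unfolding monomial_in_Idl_iff by (auto simp: T_def)
    then show ?thesis
      by (simp add: monomial_def mult_single)
  qed
  \<comment> \<open>The colon ideal of \<open>?M\<close> by \<open>?s\<close> contains every
    variable, hence the whole irrelevant ideal.\<close>
  have "ideal {f. f * ?s \<in> ?M} mpoly_ring"
  proof (rule ideal_mpoly_ringI)
    show "0 \<in> {f. f * ?s \<in> ?M}"
      using M.zero_closed by simp
    show "f + g \<in> {f. f * ?s \<in> ?M}" if "f \<in> {f. f * ?s \<in> ?M}" "g \<in> {f. f * ?s \<in> ?M}" for f g
      using that M.a_closed[of "f * ?s" "g * ?s"] by (simp add: distrib_right)
    show "g * f \<in> {f. f * ?s \<in> ?M}" if "f \<in> {f. f * ?s \<in> ?M}" for f g
      using that M.I_l_closed[of "f * ?s" g] by (simp add: mult.assoc)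
  qed
  then have "irrelevant_ideal \<subseteq> {f. f * ?s \<in> ?M}"
    unfolding irrelevant_ideal_def by (rule genideal_minimal) (use socle in auto)
  moreover have "?s \<notin> ?M"
    using s(1) by (auto simp: monomial_in_Idl_iff T_def)
  ultimately show ?thesis
    by (intro depth_quot_module_eq_0[OF M.is_ideal, of ?s]) auto
qed


section \<open>Monomials near a balanced exponent\<close>

text \<open>These are the degree \<open>D\<close> monomials that divide some power of x_i times the
  balanced monomial with all exponents \<open>q\<close>.\<close>

definition cone_exponents :: "nat \<Rightarrow> nat \<Rightarrow> 'n \<Rightarrow> ('n::finite \<Rightarrow>\<^sub>0 nat) set" where
  "cone_exponents D q i =
     {a. (\<Sum>j\<in>UNIV. Poly_Mapping.lookup a j) = D \<and> (\<forall>j. j \<noteq> i \<longrightarrow> Poly_Mapping.lookup a j \<le> q)}"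

text \<open>The balanced monomial has degree below \<open>D\<close>, so no generator divides it, and
  the cones force depth 0. The missing pure power forces dimension at least 1.\<close>

lemma not_cohen_macaulay_quotI:
  fixes A :: "('n::finite \<Rightarrow>\<^sub>0 nat) set"
  assumes deg: "\<And>a. a \<in> A \<Longrightarrow> (\<Sum>j\<in>UNIV. Poly_Mapping.lookup a j) = D" and q: "CARD('n) * q < D"
    and pure: "Poly_Mapping.single i D \<notin> A"
    and cone: "\<And>j. A \<inter> cone_exponents D q j \<noteq> {}"
  shows "\<not> cohen_macaulay_quot (Idl\<^bsub>mpoly_ring\<^esub> (monomial ` A) :: ('n, 'k::field) mpoly set)"
proof -
  define c :: "'n \<Rightarrow>\<^sub>0 nat" where "c = Abs_poly_mapping (\<lambda>_. q)"
  have c: "Poly_Mapping.lookup c j = q" for j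
    by (simp add: c_def)
  have "\<not> exponent_dvd a c" if "a \<in> A" for a
  proof
    assume "exponent_dvd a c"
    then have "D \<le> (\<Sum>j\<in>(UNIV :: 'n set). q)"
      unfolding deg[OF that, symmetric] by (intro sum_mono) (simp add: exponent_dvd_def c)
    then show False
      using q by simp
  qed
  then have "depth irrelevant_ideal (quot_module (mpoly_ring :: ('n, 'k) mpoly ring)
      (Idl\<^bsub>mpoly_ring\<^esub> (monomial ` A))) = 0"
  proof (rule depth_monomial_quot_eq_0)
    show "\<exists>a\<in>A. \<forall>j. j \<noteq> i \<longrightarrow> Poly_Mapping.lookup a j \<le> Poly_Mapping.lookup c j" for i
      using cone[of i] by (auto simp: c cone_exponents_def)
  qed
  \<comment> \<open>Pure powers of x_i other than the \<open>D\<close>-th are excluded by their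
    degree.\<close>
  moreover have "Poly_Mapping.single i m \<notin> A" for m
  proof
    assume m: "Poly_Mapping.single i m \<in> A"
    then have "m = D"
      using deg[OF m] by (simp add: lookup_single when_def)
    with m pure show False
      by simp
  qed
  then have "1 \<le> krull_dim ((mpoly_ring :: ('n, 'k) mpoly ring) Quot
      (Idl\<^bsub>mpoly_ring\<^esub> (monomial ` A)))"
    by (rule one_le_krull_dim_monomial_quot)
  ultimately show ?thesis
    by (auto simp: cohen_macaulay_quot_def)
qed

section \<open>Counting the monomials of a cone\<close>

lemma inj_monomial: "inj (monomial :: _ \<Rightarrow> ('n::finite, 'k::field) mpoly)"
proof (rule injI)
  fix a b assume "(monomial a :: ('n, 'k) mpoly) = monomial b"
  then have "Poly_Mapping.keys (monomial a :: ('n, 'k) mpoly) = Poly_Mapping.keys (monomial b :: ('n, 'k) mpoly)"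
    by simp
  then show "a = b"
    by (simp add: monomial_def)
qed

lemma cone_monomials_subset:
  "monomial ` cone_exponents D q i \<subseteq> monomials_of_degree D"
  by (auto simp: cone_exponents_def monomials_of_degree_def)

lemma card_cone_monomials_ge:
  fixes i :: "'n::finite"
  assumes q: "CARD('n) * q < D"
  shows "(q + 1) ^ (CARD('n) - 1) \<le>
    card (monomial ` cone_exponents D q i :: ('n, 'k::field) mpoly set)"
proof -
  let ?U = "UNIV - {i}"
  let ?F = "PiE ?U (\<lambda>_. {..q})"
  \<comment> \<open>The entries off \<open>i\<close> are chosen freely in \<open>{..q}\<close>, and
    entry \<open>i\<close> fills up the degree. The subtraction is not truncated, as
    \<open>CARD('n) * q < D\<close>.\<close>
  define e where "e = (\<lambda>f :: 'n \<Rightarrow> nat. Abs_poly_mapping (\<lambda>j. if j = i then D - sum f ?U else f j))"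
  have e: "Poly_Mapping.lookup (e f) j = (if j = i then D - sum f ?U else f j)" for f j
    by (simp add: e_def)
  have "inj_on e ?F"
  proof (rule inj_onI)
    fix f g assume "f \<in> ?F" "g \<in> ?F" "e f = e g"
    then have "f j = g j" if "j \<noteq> i" for j
      using that e[of f j] e[of g j] by simp
    with \<open>f \<in> ?F\<close> \<open>g \<in> ?F\<close> show "f = g"
      by (intro PiE_ext[of f ?U "\<lambda>_. {..q}" g]) auto
  qed
  moreover have "e ` ?F \<subseteq> cone_exponents D q i"
  proof (rule image_subsetI)
    fix f assume f: "f \<in> ?F"
    then have "sum f ?U \<le> (\<Sum>j\<in>?U. q)"
      by (intro sum_mono) (auto simp: PiE_iff)
    also have "\<dots> \<le> (\<Sum>j\<in>(UNIV :: 'n set). q)"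
      by (intro sum_mono2) auto
    finally have "sum f ?U \<le> D"
      using q by simp
    moreover have "(\<Sum>j\<in>UNIV. Poly_Mapping.lookup (e f) j) = (D - sum f ?U) + sum f ?U"
      by (subst sum.remove[of UNIV i]) (auto simp: e)
    ultimately show "e f \<in> cone_exponents D q i"
      using f by (auto simp: cone_exponents_def e PiE_iff)
  qed
  moreover have "finite (monomial ` cone_exponents D q i :: ('n, 'k) mpoly set)"
    using cone_monomials_subset finite_monomials_of_degree by (rule finite_subset)
  then have "finite (cone_exponents D q i)"
    by (rule finite_imageD) (rule inj_on_subset[OF inj_monomial], simp)
  ultimately have "card ?F \<le> card (cone_exponents D q i)"
    by (metis card_inj_on_le)
  moreover have "card ?F = (q + 1) ^ (CARD('n) - 1)"
    by (simp add: card_PiE)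
  moreover have "card (monomial ` cone_exponents D q i :: ('n, 'k) mpoly set) = card (cone_exponents D q i)"
    by (rule card_image) (rule inj_on_subset[OF inj_monomial], simp)
  ultimately show ?thesis
    by simp
qed


section \<open>The random monomial ideal\<close>

text \<open>The event is a product of coordinate events; each coordinate in \<open>B\<close>
  contributes \<open>1 - q\<close>, every other one contributes 1.\<close>

lemma prob_Pi_pmf_bernoulli_none:
  assumes "finite A" "B \<subseteq> A" "0 \<le> q" "q \<le> 1"
  shows "measure_pmf.prob (Pi_pmf A False (\<lambda>_. bernoulli_pmf q)) {b. \<forall>x\<in>B. \<not> b x} =
    (1 - q) ^ card B"
proof -
  let ?S = "\<lambda>x. if x \<in> B then {False} else UNIV"
  have "{b. \<forall>x\<in>B. \<not> b x} = Pi A ?S"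
    using assms(2) by (auto simp: Pi_def)
  then have "measure_pmf.prob (Pi_pmf A False (\<lambda>_. bernoulli_pmf q)) {b. \<forall>x\<in>B. \<not> b x} =
      (\<Prod>x\<in>A. measure_pmf.prob (bernoulli_pmf q) (?S x))"
    by (simp add: measure_Pi_pmf_Pi assms(1))
  also have "\<dots> = (\<Prod>x\<in>A. if x \<in> B then 1 - q else 1)"
    using assms(3,4) by (intro prod.cong) (auto simp: measure_pmf_single)
  also have "\<dots> = (1 - q) ^ card B"
    using assms(1,2) by (simp add: prod.If_cases Int_absorb1)
  finally show ?thesis .
qed

text \<open>A union bound over the bad events: one fixed pure power is drawn, or one of the
  \<open>CARD('n)\<close> cones is missed.\<close>

lemma prob_not_cohen_macaulay_ge:
  fixes D q :: nat
  assumes r: "0 \<le> r" "r \<le> 1" and q: "CARD('n::finite) * q < D"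
  shows "1 - r - real CARD('n) * (1 - r) ^ ((q + 1) ^ (CARD('n) - 1)) \<le>
    measure_pmf.prob (random_monomial_ideal D r :: ('n, 'k::field) mpoly set pmf)
      {M. \<not> cohen_macaulay_quot M}"
proof -
  let ?X = "monomials_of_degree D :: ('n, 'k) mpoly set"
  let ?P = "Pi_pmf ?X False (\<lambda>_. bernoulli_pmf r)"
  let ?C = "\<lambda>i. monomial ` cone_exponents D q i :: ('n, 'k) mpoly set"
  \<comment> \<open>Any variable will do.\<close>
  define i :: 'n where "i = undefined"
  let ?x = "monomial (Poly_Mapping.single i D) :: ('n, 'k) mpoly"
  let ?bad = "{b. b ?x} \<union> (\<Union>j. {b. \<forall>m\<in>?C j. \<not> b m})"
  let ?good = "{b. \<not> cohen_macaulay_quot (Idl\<^bsub>mpoly_ring\<^esub> {m \<in> ?X. b m})}"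
  have x: "?x \<in> ?X"
    by (auto simp: monomials_of_degree_def lookup_single when_def)
  have "b \<in> ?good" if "b \<notin> ?bad" for b
  proof -
    define A where "A = {a. (\<Sum>j\<in>UNIV. Poly_Mapping.lookup a j) = D \<and> b (monomial a :: ('n, 'k) mpoly)}"
    have "{m \<in> ?X. b m} = monomial ` A"
      by (auto simp: A_def monomials_of_degree_def)
    moreover have "A \<inter> cone_exponents D q j \<noteq> {}" for j
      using that by (auto simp: A_def cone_exponents_def)
    then have "\<not> cohen_macaulay_quot (Idl\<^bsub>mpoly_ring\<^esub> (monomial ` A) :: ('n, 'k) mpoly set)"
      using that q by (intro not_cohen_macaulay_quotI[of A D q i]) (auto simp: A_def)
    ultimately show ?thesis
      by simp
  qed
  then have "- ?bad \<subseteq> ?good"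
    by blast
  then have good: "1 - measure_pmf.prob ?P ?bad \<le> measure_pmf.prob ?P ?good"
    using measure_pmf.prob_compl[of ?bad ?P] measure_pmf.finite_measure_mono[of "- ?bad" ?good ?P]
    by (simp add: Compl_eq_Diff_UNIV)
  have "measure_pmf.prob ?P {b. b ?x} = measure_pmf.prob (map_pmf (\<lambda>b. b ?x) ?P) {True}"
    by (simp add: vimage_def)
  also have "\<dots> = r"
    using x r by (subst Pi_pmf_component) (simp_all add: finite_monomials_of_degree measure_pmf_single)
  finally have px: "measure_pmf.prob ?P {b. b ?x} = r" .
  \<comment> \<open>The base lies in [0,1], so the lower bound on the size of a cone gives an upper
    bound on the power.\<close>
  have pC: "measure_pmf.prob ?P {b. \<forall>m\<in>?C j. \<not> b m} \<le> (1 - r) ^ ((q + 1) ^ (CARD('n) - 1))" for j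
    unfolding prob_Pi_pmf_bernoulli_none[OF finite_monomials_of_degree cone_monomials_subset r]
    using r by (intro power_decreasing card_cone_monomials_ge q) auto
  have "measure_pmf.prob ?P ?bad \<le> measure_pmf.prob ?P {b. b ?x} +
      measure_pmf.prob ?P (\<Union>j. {b. \<forall>m\<in>?C j. \<not> b m})"
    by (rule measure_Un_le) auto
  also have "measure_pmf.prob ?P (\<Union>j. {b. \<forall>m\<in>?C j. \<not> b m}) \<le>
      (\<Sum>j\<in>UNIV. measure_pmf.prob ?P {b. \<forall>m\<in>?C j. \<not> b m})"
    by (rule measure_UNION_le) auto
  also have "\<dots> \<le> (\<Sum>j\<in>(UNIV :: 'n set). (1 - r) ^ ((q + 1) ^ (CARD('n) - 1)))"
    by (intro sum_mono pC)
  finally have "measure_pmf.prob ?P ?bad \<le> r + real CARD('n) * (1 - r) ^ ((q + 1) ^ (CARD('n) - 1))"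
    by (simp add: px)
  with good have "1 - r - real CARD('n) * (1 - r) ^ ((q + 1) ^ (CARD('n) - 1)) \<le>
      measure_pmf.prob ?P ?good"
    by linarith
  also have "\<dots> = measure_pmf.prob (random_monomial_ideal D r :: ('n, 'k) mpoly set pmf)
      {M. \<not> cohen_macaulay_quot M}"
    by (simp add: random_monomial_ideal_def random_monomials_def vimage_def)
  finally show ?thesis .
qed

section \<open>Passage to the limit\<close>

theorem corollary1p2:
  fixes p :: "nat \<Rightarrow> real"
  assumes "\<And>D. D > 0 \<Longrightarrow> 0 \<le> p D \<and> p D \<le> 1"
    and "(\<lambda>D. real D powi (- int CARD('n::finite) + 1)) \<in> o(p)"
    and "p \<in> o(\<lambda>_. 1)"
  shows "(\<lambda>D. measure_pmf.prob
            (random_monomial_ideal D (p D) :: ('n, 'k::field) mpoly set pmf)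
            {M. \<not> cohen_macaulay_quot M}) \<longlonglongrightarrow> 1"
proof -
  define n where "n = CARD('n)"
  have n: "n > 0"
    by (simp add: n_def)
  \<comment> \<open>For positive \<open>D\<close>, the largest value with
    \<open>n * q D < D\<close>, which makes the cones as large as possible.\<close>
  define q where "q = (\<lambda>D. (D - 1) div n)"
  have q: "n * q D < D" "real D / real n \<le> real (q D + 1)" if "D > 0" for D
  proof -
    have "n * q D \<le> D - 1"
      by (simp add: q_def)
    then show "n * q D < D"
      using that by linarith
    have "D - 1 < n * (q D + 1)"
      using n dividend_less_times_div[of n "D - 1"] by (simp add: q_def)
    then have "D \<le> n * (q D + 1)"
      by linarith
    then have "real D \<le> real n * real (q D + 1)"
      by (metis of_nat_le_iff of_nat_mult)
    then show "real D / real n \<le> real (q D + 1)"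
      using n by (simp add: divide_le_eq mult.commute)
  qed
  have p0: "p \<longlonglongrightarrow> 0"
    using smalloD_tendsto[OF assms(3)] by simp
  have "filterlim (\<lambda>D. p D * real D ^ (n - 1)) at_top sequentially"
    unfolding filterlim_at_top_gt[where c = 0]
  proof (intro allI impI)
    fix Z :: real assume Z: "Z > 0"
    \<comment> \<open>The little-o bound with constant \<open>1 / Z\<close> rearranges to the
      required lower bound \<open>Z\<close>.\<close>
    have "eventually (\<lambda>D. norm (real D powi (- int CARD('n) + 1)) \<le> (1 / Z) * norm (p D)) sequentially"
      using Z by (intro landau_o.smallD[OF assms(2)]) simp
    then show "eventually (\<lambda>D. Z \<le> p D * real D ^ (n - 1)) sequentially"
      using eventually_gt_at_top[of 0]
    proof eventually_elim
      case (elim D)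
      have "- int CARD('n) + 1 = - int (n - 1)"
        using n by (simp add: n_def of_nat_diff)
      then have "real D powi (- int CARD('n) + 1) = 1 / real D ^ (n - 1)"
        by (simp add: power_int_minus divide_inverse)
      then have "1 / real D ^ (n - 1) \<le> p D / Z"
        using elim assms(1)[of D] by simp
      then show ?case
        using elim(2) Z by (simp add: field_simps)
    qed
  qed
  then have "filterlim (\<lambda>D. (1 / real n ^ (n - 1)) * (p D * real D ^ (n - 1))) at_top sequentially"
    using n by (intro filterlim_tendsto_pos_mult_at_top[OF tendsto_const]) simp_all
  then have exp0: "(\<lambda>D. exp (- ((1 / real n ^ (n - 1)) * (p D * real D ^ (n - 1))))) \<longlonglongrightarrow> 0"
    by (intro filterlim_compose[OF exp_at_bot] filterlim_compose[OF filterlim_uminus_at_bot_at_top])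
  \<comment> \<open>This comes from the union bound via 1 - x \<le> exp(-x) and q + 1 \<ge> D/n; the
    probability is squeezed between \<open>?l\<close> and 1.\<close>
  let ?l = "\<lambda>D. 1 - p D - real n * exp (- ((1 / real n ^ (n - 1)) * (p D * real D ^ (n - 1))))"
  have "?l \<longlonglongrightarrow> 1 - 0 - real n * 0"
    by (intro tendsto_intros p0 exp0)
  then have l: "?l \<longlonglongrightarrow> 1"
    by simp
  show ?thesis
  proof (rule tendsto_sandwich[OF _ _ l tendsto_const])
    show "eventually (\<lambda>D. ?l D \<le> measure_pmf.prob
            (random_monomial_ideal D (p D) :: ('n, 'k) mpoly set pmf)
            {M. \<not> cohen_macaulay_quot M}) sequentially"
      using eventually_gt_at_top[of 0]
    proof eventually_elim
      case (elim D)
      have pD: "0 \<le> p D" "p D \<le> 1"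
        using assms(1)[OF elim] by auto
      let ?N = "(q D + 1) ^ (n - 1)"
      have "(1 - p D) ^ ?N \<le> exp (- p D) ^ ?N"
        using pD exp_ge_add_one_self[of "- p D"] by (intro power_mono) auto
      also have "\<dots> = exp (- (p D * real ?N))"
        by (simp add: exp_of_nat_mult[symmetric] mult.commute)
      also have "\<dots> \<le> exp (- ((1 / real n ^ (n - 1)) * (p D * real D ^ (n - 1))))"
      proof -
        have "(real D / real n) ^ (n - 1) \<le> real (q D + 1) ^ (n - 1)"
          by (intro power_mono q(2) elim) simp
        then have "p D * (real D / real n) ^ (n - 1) \<le> p D * real ?N"
          using pD by (intro mult_left_mono) simp_all
        then show ?thesis
          by (simp add: power_divide)
      qed
      finally have "real n * (1 - p D) ^ ?N \<le>
          real n * exp (- ((1 / real n ^ (n - 1)) * (p D * real D ^ (n - 1))))"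
        by (intro mult_left_mono) simp_all
      then show ?case
        using prob_not_cohen_macaulay_ge[where 'n = 'n and 'k = 'k, OF pD q(1)[OF elim, unfolded n_def]]
        unfolding n_def[symmetric] by linarith
    qed
  qed (simp add: measure_pmf.prob_le_1)
qed

end
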